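(* Let $\dot x=f(x)$ be a system that is conservative (respectively dissipative) with respect to a function $H$, i.e. $\nabla H(x)^\top f(x)=0$ (respectively $\le 0$) for all $x\in U$. Let $\widetilde H$, $G$, $\mathcal M=\{(x,\varphi(x)):x\in U\}$, $\tilde f$ and the extended system $$\begin{pmatrix}\dot x\\ \dot y\end{pmatrix}=F(x,y):=\begin{pmatrix}\tilde f(x,y)\\ -B^\dagger(x,y)A(x,y)\tilde f(x,y)\end{pmatrix}$$ be as defined in the context. Then the extended system is equivalent to the original system on the constraint manifold $\mathcal M$: a curve $(x(t),y(t))$ lying in $\mathcal M$ is a solution of the extended system if and only if $y(t)=\varphi(x(t))$ and $x(t)$ is a solution of $\dot x=f(x)$. Moreover, the extended system inherits the same conservative (respectively dissipative) property: for all $(x,y)\in\mathcal M$, $$\nabla\widetilde H(x,y)^\top F(x,y)=0\quad(\text{respectively }\le 0).$$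
   Context: Let $U\subset\mathbb{R}^n$ and $D\subset\mathbb{R}^{n+d}$ be open, $f:U\to\mathbb{R}^n$ and $H:U\to\mathbb{R}$ smooth. The function $H$ is represented by a quadratic function $\widetilde H:\mathbb{R}^{n+d}\to\mathbb{R}$ and a constraint map $G=(G_1,\ldots,G_d)^\top$, where each component is a homogeneous quadratic polynomial $$G_i(x,y)=\tfrac12 z^\top Q^i z,\quad z=(x^\top,y^\top)^\top\in\mathbb{R}^{n+d},\quad Q^i=\begin{pmatrix}Q^i_{11}&Q^i_{12}\\(Q^i_{12})^\top&Q^i_{22}\end{pmatrix}\ \text{symmetric}.$$ Write the Jacobian as $DG(x,y)=(A(x,y)\mid B(x,y))$, where $A(x,y)\in\mathbb{R}^{d\times n}$ has $i$-th row $x^\top Q^i_{11}+y^\top (Q^i_{12})^\top$ and $B(x,y)\in\mathbb{R}^{d\times d}$ has $i$-th row $x^\top Q^i_{12}+y^\top Q^i_{22}$. Standing assumptions: $B(x,y)$ has full rank for $(x,y)\in D$, and $B^\dagger=(B^\top B)^{-1}B^\top$ is its Moore–Penrose inverse. The constraint manifold $\mathcal M=\{(x,y)\in D:G(x,y)=0\}$ is the graph $\{(x,\varphi(x)):x\in U\}$ of a smooth function $\varphi:U\to\mathbb{R}^d$, and $\widetilde H(x,y)=H(x)$ for $(x,y)\in\mathcal M$. The smooth map $\tilde f:D\to\mathbb{R}^n$ is consistent with $f$, meaning $\tilde f(x,\varphi(x))=f(x)$ for all $x\in U$. *)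

theory Defs
  imports "HOL-Analysis.Analysis"
begin

text \<open>
  \<open>C\<^sup>k\<close> and smooth maps, via iterated directional derivatives. The notions are meant for open \<open>S\<close>,
  where \<^term>\<open>at x\<close> only sees the values of the map on \<open>S\<close>.
\<close>

primrec Ck_on :: "nat \<Rightarrow> 'a::real_normed_vector set \<Rightarrow> ('a \<Rightarrow> 'b::real_normed_vector) \<Rightarrow> bool" where
  "Ck_on 0 S g \<longleftrightarrow> continuous_on S g"
| "Ck_on (Suc k) S g \<longleftrightarrow> (\<forall>x\<in>S. g differentiable (at x)) \<and>
     (\<forall>v. Ck_on k S (\<lambda>x. frechet_derivative g (at x) v))"

definition smooth_on :: "'a::real_normed_vector set \<Rightarrow> ('a \<Rightarrow> 'b::real_normed_vector) \<Rightarrow> bool" where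
  "smooth_on S g \<longleftrightarrow> (\<forall>k. Ck_on k S g)"

definition grad :: "('a::real_inner \<Rightarrow> real) \<Rightarrow> 'a \<Rightarrow> 'a" where
  "grad h z = (THE g. GDERIV h z :> g)"

definition conservative :: "'a::real_inner set \<Rightarrow> ('a \<Rightarrow> 'a) \<Rightarrow> ('a \<Rightarrow> real) \<Rightarrow> bool" where
  "conservative S g h \<longleftrightarrow> (\<forall>z\<in>S. grad h z \<bullet> g z = 0)"

definition dissipative :: "'a::real_inner set \<Rightarrow> ('a \<Rightarrow> 'a) \<Rightarrow> ('a \<Rightarrow> real) \<Rightarrow> bool" where
  "dissipative S g h \<longleftrightarrow> (\<forall>z\<in>S. grad h z \<bullet> g z \<le> 0)"

definition solution_on ::
    "real set \<Rightarrow> 'a::real_normed_vector set \<Rightarrow> ('a \<Rightarrow> 'a) \<Rightarrow> (real \<Rightarrow> 'a) \<Rightarrow> bool" where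
  "solution_on J S g c \<longleftrightarrow>
     (\<forall>t\<in>J. c t \<in> S \<and> (c has_vector_derivative g (c t)) (at t within J))"

text \<open>A quadratic function may have linear and constant terms.\<close>

definition quadratic_function :: "('a::real_inner \<Rightarrow> real) \<Rightarrow> bool" where
  "quadratic_function h \<longleftrightarrow>
     (\<exists>L b c. linear L \<and> (\<forall>z. h z = z \<bullet> L z + b \<bullet> z + c))"

text \<open>
  Points of \<open>\<real>\<^bsup>n+d\<^esup>\<close> are pairs of type \<^typ>\<open>(real^'n) \<times> (real^'d)\<close>. Only to multiply with the
  \<open>(n+d) \<times> (n+d)\<close> matrices \<open>Q\<^sup>i\<close>, a pair is turned into a vector indexed by \<^typ>\<open>'n + 'd\<close>.
\<close>

definition stack :: "real^'n \<Rightarrow> real^'d \<Rightarrow> real^('n::finite + 'd::finite)" where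
  "stack x y = (\<chi> k. case k of Inl j \<Rightarrow> x $ j | Inr j \<Rightarrow> y $ j)"

definition block11 :: "real^('n::finite + 'd::finite)^('n + 'd) \<Rightarrow> real^'n^'n" where
  "block11 M = (\<chi> i j. M $ Inl i $ Inl j)"

definition block12 :: "real^('n::finite + 'd::finite)^('n + 'd) \<Rightarrow> real^'d^'n" where
  "block12 M = (\<chi> i j. M $ Inl i $ Inr j)"

definition block22 :: "real^('n::finite + 'd::finite)^('n + 'd) \<Rightarrow> real^'d^'d" where
  "block22 M = (\<chi> i j. M $ Inr i $ Inr j)"

definition constraint_map ::
    "('d \<Rightarrow> real^('n::finite + 'd::finite)^('n + 'd)) \<Rightarrow> (real^'n) \<times> (real^'d) \<Rightarrow> real^'d" where
  "constraint_map Q = (\<lambda>(x, y). \<chi> i. (1/2) * (stack x y \<bullet> (Q i *v stack x y)))"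

text \<open>For symmetric \<open>Q\<^sup>i\<close>, the Jacobian matrix of \<^term>\<open>constraint_map Q\<close> is \<open>(jac_x Q | jac_y Q)\<close>.\<close>

definition jac_x ::
    "('d \<Rightarrow> real^('n::finite + 'd::finite)^('n + 'd)) \<Rightarrow> (real^'n) \<times> (real^'d) \<Rightarrow> real^'n^'d" where
  "jac_x Q = (\<lambda>(x, y). \<chi> i. x v* block11 (Q i) + y v* transpose (block12 (Q i)))"

definition jac_y ::
    "('d \<Rightarrow> real^('n::finite + 'd::finite)^('n + 'd)) \<Rightarrow> (real^'n) \<times> (real^'d) \<Rightarrow> real^'d^'d" where
  "jac_y Q = (\<lambda>(x, y). \<chi> i. x v* block12 (Q i) + y v* block22 (Q i))"

text \<open>The Moore-Penrose inverse of a matrix of full column rank.\<close>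

definition mp_inverse :: "real^'c^'r \<Rightarrow> real^'r^'c" where
  "mp_inverse M = matrix_inv (transpose M ** M) ** transpose M"

definition constraint_manifold ::
    "((real^'n) \<times> (real^'d)) set \<Rightarrow> ('d \<Rightarrow> real^('n::finite + 'd::finite)^('n + 'd))
      \<Rightarrow> ((real^'n) \<times> (real^'d)) set" where
  "constraint_manifold D Q = {z \<in> D. constraint_map Q z = 0}"

definition extended_field ::
    "('d \<Rightarrow> real^('n::finite + 'd::finite)^('n + 'd)) \<Rightarrow> ((real^'n) \<times> (real^'d) \<Rightarrow> real^'n)
      \<Rightarrow> (real^'n) \<times> (real^'d) \<Rightarrow> (real^'n) \<times> (real^'d)" where
  "extended_field Q ft z =
     (ft z, - (mp_inverse (jac_y Q z) *v (jac_x Q z *v ft z)))"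

end

theory Submission
  imports Defs
begin

text \<open>
  Everything rests on one identity. The constraint vanishes along the graph of \<open>\<phi>\<close>, so
  differentiating \<open>G(x, \<phi> x) = 0\<close> gives \<open>A v + B (\<phi>' x v) = 0\<close> for every direction \<open>v\<close>. As \<open>B\<close> has
  full column rank, \<open>B\<^sup>\<dagger>\<close> is a left inverse of it (\<open>mp_inverse_left_inverse\<close>), and hence
  \<open>\<phi>' x v = - B\<^sup>\<dagger> A v\<close> (\<open>graph_derivative_eq\<close>). On the manifold the extended field is therefore the lift
  \<open>(f x, \<phi>' x (f x))\<close> of \<open>f\<close> to the tangent space of the graph.

  Both claims follow by the chain rule. The second component of the extended system holds
  automatically for \<open>y = \<phi> \<circ> x\<close> whenever \<open>x\<close> solves the original system, and the first component
  of the extended system is the original one (\<open>graph_curve_solution_iff\<close>). Differentiating \<open>H = Ht \<circ> (id, \<phi>)\<close> shows that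
  \<open>grad Ht \<bullet> (v, \<phi>' x v) = grad H \<bullet> v\<close> (\<open>grad_graph_chain_rule\<close>), and \<open>v = f x\<close>
  transfers the sign of the energy rate from \<open>f\<close> to the extended field.
\<close>

text \<open>
  The normal matrix \<open>M\<^sup>T M\<close> is invertible because \<open>M\<^sup>T M v = 0\<close> implies
  \<open>norm (M v)\<^sup>2 = v \<bullet> M\<^sup>T M v = 0\<close>.
\<close>

lemma mp_inverse_left_inverse:
  fixes M :: "real^'c^'r"
  assumes "rank M = CARD('c)"
  shows "mp_inverse M ** M = mat 1"
proof -
  have M_inj: "inj ((*v) M)"
    using assms full_rank_injective by blast
  have "v = 0" if "(transpose M ** M) *v v = 0" for v
  proof -
    have "(M *v v) \<bullet> (M *v v) = v \<bullet> ((transpose M ** M) *v v)"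
      by (metis dot_lmul_matrix matrix_vector_mul_assoc transpose_matrix_vector transpose_transpose)
    then have "M *v v = M *v 0"
      using that by simp
    then show ?thesis
      using M_inj by (blast dest: injD)
  qed
  then have "invertible (transpose M ** M)"
    using invertible_left_inverse matrix_left_invertible_ker by blast
  then have "matrix_inv (transpose M ** M) ** (transpose M ** M) = mat 1"
    unfolding matrix_inv_def invertible_def by (rule someI2_ex) blast
  then show ?thesis
    by (simp add: mp_inverse_def matrix_mul_assoc)
qed

lemma sum_UNIV_Plus:
  fixes g :: "('a::finite + 'b::finite) \<Rightarrow> 'c::comm_monoid_add"
  shows "(\<Sum>k\<in>UNIV. g k) = (\<Sum>i\<in>UNIV. g (Inl i)) + (\<Sum>j\<in>UNIV. g (Inr j))"
  by (simp add: UNIV_Plus_UNIV[symmetric] sum.Plus comp_def del: UNIV_Plus_UNIV)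

lemma inner_stack: "stack a b \<bullet> stack c d = a \<bullet> c + b \<bullet> d"
  by (simp add: inner_vec_def stack_def sum_UNIV_Plus)

text \<open>Symmetry enters here: the lower left block of \<open>M\<close> is \<open>transpose (block12 M)\<close>.\<close>

lemma symmetric_matrix_mult_stack:
  fixes M :: "real^('n::finite + 'd::finite)^('n + 'd)"
  assumes "transpose M = M"
  shows "M *v stack v w =
    stack (block11 M *v v + block12 M *v w) (transpose (block12 M) *v v + block22 M *v w)"
proof -
  have sym: "M $ Inr j $ Inl i = M $ Inl i $ Inr j" for i j
    by (subst assms[symmetric]) (simp add: transpose_def)
  have "(M *v stack v w) $ k = stack (block11 M *v v + block12 M *v w)
      (transpose (block12 M) *v v + block22 M *v w) $ k" for k
    by (cases k) (simp_all add: matrix_vector_mult_def stack_def block11_def block12_def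
        block22_def transpose_def sum_UNIV_Plus sym)
  then show ?thesis
    unfolding vec_eq_iff by blast
qed

lemma bounded_linear_stack:
  "bounded_linear (\<lambda>z. stack (fst z) (snd z) :: real^('n::finite + 'd::finite))"
  unfolding linear_conv_bounded_linear[symmetric]
  by (rule linearI) (auto simp: vec_eq_iff stack_def split: sum.split)

lemma jacobian_component:
  fixes Q :: "'d \<Rightarrow> real^('n::finite + 'd::finite)^('n + 'd)"
  assumes "transpose (Q i) = Q i"
  shows "(jac_x Q z *v v + jac_y Q z *v w) $ i =
    stack (fst z) (snd z) \<bullet> (Q i *v stack v w)"
proof -
  have row: "(M *v u) $ i = M $ i \<bullet> u" for M :: "real^'m^'d" and u
    by (simp add: matrix_vector_mult_def inner_vec_def)
  have "(jac_x Q z *v v) $ i = (fst z v* block11 (Q i) + snd z v* transpose (block12 (Q i))) \<bullet> v"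
    unfolding row by (simp add: jac_x_def split_beta)
  moreover have "(jac_y Q z *v w) $ i = (fst z v* block12 (Q i) + snd z v* block22 (Q i)) \<bullet> w"
    unfolding row by (simp add: jac_y_def split_beta)
  ultimately show ?thesis
    unfolding symmetric_matrix_mult_stack[OF assms] inner_stack vector_add_component
      inner_add_left inner_add_right dot_lmul_matrix
    by linarith
qed

text \<open>
  The product rule for \<open>z \<bullet> Q\<^sup>i z / 2\<close> produces two terms, which agree because \<open>Q\<^sup>i\<close> is symmetric;
  this cancels the factor \<open>1/2\<close>.
\<close>

lemma constraint_map_has_derivative:
  fixes Q :: "'d \<Rightarrow> real^('n::finite + 'd::finite)^('n + 'd)"
  assumes "\<And>i. transpose (Q i) = Q i"
  shows "(constraint_map Q has_derivative (\<lambda>h. jac_x Q z *v fst h + jac_y Q z *v snd h)) (at z)"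
proof -
  define s where "s = (\<lambda>z::(real^'n) \<times> (real^'d). stack (fst z) (snd z))"
  have s_deriv: "(s has_derivative s) (at z)"
    unfolding s_def by (rule bounded_linear_imp_has_derivative[OF bounded_linear_stack])
  have comp: "((\<lambda>z. constraint_map Q z $ i) has_derivative
      (\<lambda>h. (jac_x Q z *v fst h + jac_y Q z *v snd h) $ i)) (at z)" for i
  proof -
    have Qs_deriv: "((\<lambda>z. Q i *v s z) has_derivative (\<lambda>h. Q i *v s h)) (at z)"
      using bounded_linear.has_derivative[OF matrix_vector_mul_bounded_linear s_deriv] .
    have swap: "s h \<bullet> (Q i *v s z) = s z \<bullet> (Q i *v s h)" for h
      by (metis assms dot_lmul_matrix inner_commute transpose_matrix_vector)
    have "((\<lambda>z. (1/2) * (s z \<bullet> (Q i *v s z))) has_derivative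
        (\<lambda>h. (1/2) * (s z \<bullet> (Q i *v s h) + s h \<bullet> (Q i *v s z)))) (at z)"
      by (intro has_derivative_mult_right has_derivative_inner s_deriv Qs_deriv)
    moreover have "constraint_map Q u $ i = (1/2) * (s u \<bullet> (Q i *v s u))" for u
      by (simp add: constraint_map_def s_def split_beta)
    moreover have "(jac_x Q z *v fst h + jac_y Q z *v snd h) $ i =
        (1/2) * (s z \<bullet> (Q i *v s h) + s h \<bullet> (Q i *v s z))" for h
      unfolding jacobian_component[OF assms] swap[of h] by (simp add: s_def)
    ultimately show ?thesis
      by (simp only:)
  qed
  show ?thesis
  proof (rule has_derivative_componentwise_within[THEN iffD2], rule ballI)
    fix b :: "real^'d"
    assume "b \<in> Basis"
    then obtain i where b: "b = axis i 1"
      by (auto simp: Basis_vec_def)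
    show "((\<lambda>u. constraint_map Q u \<bullet> b) has_derivative
        (\<lambda>h. (jac_x Q z *v fst h + jac_y Q z *v snd h) \<bullet> b)) (at z)"
      using comp[of i] unfolding b cart_eq_inner_axis .
  qed
qed

text \<open>
  This is implicit differentiation: \<open>G(u, \<phi> u)\<close> is constantly zero on the open set \<open>U\<close>, so its
  derivative \<open>A v + B (\<phi>' v)\<close> at \<open>x\<close> vanishes, and \<open>B\<^sup>\<dagger>\<close> solves this equation for \<open>\<phi>' v\<close>.
\<close>

lemma graph_derivative_eq:
  fixes Q :: "'d \<Rightarrow> real^('n::finite + 'd::finite)^('n + 'd)"
  assumes sym: "\<And>i. transpose (Q i) = Q i"
    and rank: "rank (jac_y Q (x, \<phi> x)) = CARD('d)"
    and U: "open U" "x \<in> U"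
    and zero: "\<And>u. u \<in> U \<Longrightarrow> constraint_map Q (u, \<phi> u) = 0"
    and \<phi>_deriv: "(\<phi> has_derivative \<phi>') (at x)"
  shows "\<phi>' v = - (mp_inverse (jac_y Q (x, \<phi> x)) *v (jac_x Q (x, \<phi> x) *v v))"
proof -
  let ?A = "jac_x Q (x, \<phi> x)" and ?B = "jac_y Q (x, \<phi> x)"
  have "((\<lambda>u. (u, \<phi> u)) has_derivative (\<lambda>v. (v, \<phi>' v))) (at x)"
    by (intro has_derivative_Pair has_derivative_ident \<phi>_deriv)
  from has_derivative_compose[OF this constraint_map_has_derivative[OF sym]]
  have "((\<lambda>u. constraint_map Q (u, \<phi> u)) has_derivative (\<lambda>v. ?A *v v + ?B *v \<phi>' v)) (at x)"
    by simp
  moreover have "((\<lambda>u. constraint_map Q (u, \<phi> u)) has_derivative (\<lambda>v. 0)) (at x)"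
    by (rule has_derivative_transform_within_open[OF has_derivative_const U]) (simp add: zero)
  ultimately have "(\<lambda>v. ?A *v v + ?B *v \<phi>' v) = (\<lambda>v. 0)"
    by (rule has_derivative_unique)
  then have "?A *v v + ?B *v \<phi>' v = 0"
    by (rule fun_cong)
  then have "mp_inverse ?B *v (?A *v v + ?B *v \<phi>' v) = 0"
    by simp
  then have "mp_inverse ?B *v (?B *v \<phi>' v) = - (mp_inverse ?B *v (?A *v v))"
    by (simp add: matrix_vector_right_distrib eq_neg_iff_add_eq_0 add.commute)
  then show ?thesis
    by (simp add: matrix_vector_mul_assoc mp_inverse_left_inverse[OF rank])
qed

text \<open>
  \<^const>\<open>grad\<close> is a definite description, so it has a meaning only where a gradient exists; in a
  Euclidean space the Riesz representation of the derivative provides it.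
\<close>

lemma inner_grad_eq_derivative:
  fixes h :: "'a::euclidean_space \<Rightarrow> real"
  assumes "(h has_derivative h') (at z)"
  shows "grad h z \<bullet> v = h' v"
proof -
  have lin: "linear h'"
    using assms has_derivative_linear by blast
  define g where "g = (\<Sum>b\<in>Basis. h' b *\<^sub>R b)"
  have repr: "h' v = v \<bullet> g" for v
  proof -
    have "h' v = h' (\<Sum>b\<in>Basis. (v \<bullet> b) *\<^sub>R b)"
      by (simp add: euclidean_representation)
    also have "\<dots> = (\<Sum>b\<in>Basis. (v \<bullet> b) * h' b)"
      by (simp add: linear_sum[OF lin] linear_cmul[OF lin])
    finally show ?thesis
      by (simp add: g_def inner_sum_right mult.commute)
  qed
  have "GDERIV h z :> g"
    using assms by (simp add: gderiv_def repr[symmetric])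
  moreover have "g' = g" if "GDERIV h z :> g'" for g'
  proof -
    have "(\<lambda>v. v \<bullet> g') = h'"
      using that assms has_derivative_unique unfolding gderiv_def by blast
    then have "v \<bullet> g' = v \<bullet> g" for v
      by (metis repr)
    then show ?thesis
      by (metis vector_eq_rdot inner_commute)
  qed
  ultimately have "grad h z = g"
    unfolding grad_def by (rule the_equality)
  then show ?thesis
    by (simp add: repr inner_commute)
qed

lemma quadratic_function_differentiable:
  fixes h :: "'a::euclidean_space \<Rightarrow> real"
  assumes "quadratic_function h"
  shows "h differentiable (at z)"
proof -
  obtain L b c where L: "linear L" and h: "h = (\<lambda>z. z \<bullet> L z + b \<bullet> z + c)"
    using assms unfolding quadratic_function_def by blast
  have "(L has_derivative L) (at z)"
    using L by (rule linear_imp_has_derivative)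
  then have "(h has_derivative (\<lambda>k. (z \<bullet> L k + k \<bullet> L z) + b \<bullet> k + 0)) (at z)"
    unfolding h
    by (intro has_derivative_add has_derivative_inner has_derivative_inner_right
        has_derivative_ident has_derivative_const)
  then show ?thesis
    by (auto simp: differentiable_def)
qed

text \<open>
  The values of \<open>Ht\<close> are known only on the graph, so only the component of its gradient tangent to
  the graph is determined by \<open>H\<close>; \<open>(v, \<phi>' v)\<close> is such a tangent vector.
\<close>

lemma grad_graph_chain_rule:
  fixes Ht :: "'a::euclidean_space \<times> 'b::euclidean_space \<Rightarrow> real"
  assumes U: "open U" "x \<in> U"
    and Ht: "Ht differentiable (at (x, \<phi> x))"
    and \<phi>_deriv: "(\<phi> has_derivative \<phi>') (at x)"
    and H: "\<And>u. u \<in> U \<Longrightarrow> Ht (u, \<phi> u) = H u"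
  shows "grad Ht (x, \<phi> x) \<bullet> (v, \<phi>' v) = grad H x \<bullet> v"
proof -
  obtain Ht' where Ht': "(Ht has_derivative Ht') (at (x, \<phi> x))"
    using Ht by (auto simp: differentiable_def)
  have "((\<lambda>u. (u, \<phi> u)) has_derivative (\<lambda>v. (v, \<phi>' v))) (at x)"
    by (intro has_derivative_Pair has_derivative_ident \<phi>_deriv)
  from has_derivative_compose[OF this Ht']
  have "(H has_derivative (\<lambda>v. Ht' (v, \<phi>' v))) (at x)"
    by (rule has_derivative_transform_within_open[OF _ U]) (simp add: H)
  then show ?thesis
    by (simp add: inner_grad_eq_derivative[OF Ht'] inner_grad_eq_derivative)
qed

text \<open>
  The curves are differentiated within \<open>J\<close>, where \<open>y = \<phi> \<circ> x\<close>, so an end point of \<open>J\<close> is treated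
  like an interior point.
\<close>

lemma graph_curve_solution_iff:
  fixes f :: "'a::real_normed_vector \<Rightarrow> 'a" and \<phi> :: "'a \<Rightarrow> 'b::real_normed_vector"
  assumes graph: "\<And>t. t \<in> J \<Longrightarrow> x t \<in> U \<and> y t = \<phi> (x t) \<and> (x t, y t) \<in> D"
    and \<phi>_deriv: "\<And>u. u \<in> U \<Longrightarrow> (\<phi> has_derivative \<phi>' u) (at u)"
    and F: "\<And>u. u \<in> U \<Longrightarrow> F (u, \<phi> u) = (f u, \<phi>' u (f u))"
  shows "solution_on J D F (\<lambda>t. (x t, y t)) \<longleftrightarrow> solution_on J U f x"
proof
  assume L: "solution_on J D F (\<lambda>t. (x t, y t))"
  have "(x has_vector_derivative f (x t)) (at t within J)" if t: "t \<in> J" for t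
  proof -
    have "((\<lambda>t. (x t, y t)) has_vector_derivative (f (x t), \<phi>' (x t) (f (x t)))) (at t within J)"
      using L t graph[OF t] F unfolding solution_on_def by force
    from bounded_linear.has_vector_derivative[OF bounded_linear_fst this]
    show ?thesis by simp
  qed
  then show "solution_on J U f x"
    using graph by (auto simp: solution_on_def)
next
  assume R: "solution_on J U f x"
  have "((\<lambda>t. (x t, y t)) has_vector_derivative F (x t, y t)) (at t within J)" if t: "t \<in> J" for t
  proof -
    have x_deriv: "(x has_vector_derivative f (x t)) (at t within J)"
      using R t by (simp add: solution_on_def)
    have "(\<phi> has_derivative \<phi>' (x t)) (at (x t) within x ` J)"
      using \<phi>_deriv graph[OF t] has_derivative_at_withinI by blast
    from vector_derivative_diff_chain_within[OF x_deriv this]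
    have "(y has_vector_derivative \<phi>' (x t) (f (x t))) (at t within J)"
      by (rule has_vector_derivative_transform[rotated -1]) (use t graph in auto)
    with x_deriv show ?thesis
      using graph[OF t] F by (auto intro: has_vector_derivative_Pair)
  qed
  then show "solution_on J D F (\<lambda>t. (x t, y t))"
    using graph unfolding solution_on_def by blast
qed

theorem proposition1:
  fixes U :: "(real^'n) set"
    and D :: "((real^'n) \<times> (real^'d)) set"
    and f :: "real^'n \<Rightarrow> real^'n"
    and H :: "real^'n \<Rightarrow> real"
    and Ht :: "(real^'n) \<times> (real^'d) \<Rightarrow> real"
    and Q :: "'d \<Rightarrow> real^('n + 'd)^('n + 'd)"
    and \<phi> :: "real^'n \<Rightarrow> real^'d"
    and ft :: "(real^'n) \<times> (real^'d) \<Rightarrow> real^'n"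
  assumes "open U" and "open D"
    and "smooth_on U f" and "smooth_on U H"
    and "quadratic_function Ht"
    and "\<And>i. transpose (Q i) = Q i"
    and "\<And>z. z \<in> D \<Longrightarrow> rank (jac_y Q z) = CARD('d)"
    and "smooth_on U \<phi>"
    and "constraint_manifold D Q = {(x, \<phi> x) | x. x \<in> U}"
    and "\<And>x y. (x, y) \<in> constraint_manifold D Q \<Longrightarrow> Ht (x, y) = H x"
    and "smooth_on D ft"
    and "\<And>x. x \<in> U \<Longrightarrow> ft (x, \<phi> x) = f x"
    and "conservative U f H \<or> dissipative U f H"
  shows "(\<forall>J x y. is_interval J \<and> interior J \<noteq> {} \<and>
              (\<forall>t\<in>J. (x t, y t) \<in> constraint_manifold D Q) \<longrightarrow>
            (solution_on J D (extended_field Q ft) (\<lambda>t. (x t, y t)) \<longleftrightarrow>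
               (\<forall>t\<in>J. y t = \<phi> (x t)) \<and> solution_on J U f x))
         \<and> (conservative U f H \<longrightarrow>
              conservative (constraint_manifold D Q) (extended_field Q ft) Ht)
         \<and> (dissipative U f H \<longrightarrow>
              dissipative (constraint_manifold D Q) (extended_field Q ft) Ht)"
proof -
  note M_eq = \<open>constraint_manifold D Q = {(x, \<phi> x) | x. x \<in> U}\<close>
  have on_M: "(u, \<phi> u) \<in> constraint_manifold D Q" if "u \<in> U" for u
    using that M_eq by blast
  then have on_D: "(u, \<phi> u) \<in> D" and zero: "constraint_map Q (u, \<phi> u) = 0" if "u \<in> U" for u
    using that by (auto simp: constraint_manifold_def)
  define \<phi>' where "\<phi>' u = frechet_derivative \<phi> (at u)" for u
  have "Ck_on (Suc 0) U \<phi>"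
    using \<open>smooth_on U \<phi>\<close> unfolding smooth_on_def by blast
  then have \<phi>_deriv: "(\<phi> has_derivative \<phi>' u) (at u)" if "u \<in> U" for u
    using that by (auto simp: \<phi>'_def frechet_derivative_works)
  have lift: "extended_field Q ft (u, \<phi> u) = (f u, \<phi>' u (f u))" if u: "u \<in> U" for u
    using graph_derivative_eq[where Q = Q and \<phi> = \<phi>, OF assms(6) assms(7)[OF on_D[OF u]]
        \<open>open U\<close> u zero \<phi>_deriv[OF u]] assms(12)[OF u]
    by (simp add: extended_field_def)
  \<comment> \<open>Both systems have the same energy rate, which settles the conservative and the dissipative
    case together.\<close>
  have rate: "grad Ht (u, \<phi> u) \<bullet> extended_field Q ft (u, \<phi> u) = grad H u \<bullet> f u"
    if u: "u \<in> U" for u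
    unfolding lift[OF u]
    by (rule grad_graph_chain_rule[OF \<open>open U\<close> u _ \<phi>_deriv[OF u]])
      (use assms(5,10) on_M quadratic_function_differentiable in auto)
  have equiv: "solution_on J D (extended_field Q ft) (\<lambda>t. (x t, y t)) \<longleftrightarrow>
      (\<forall>t\<in>J. y t = \<phi> (x t)) \<and> solution_on J U f x"
    if "\<forall>t\<in>J. (x t, y t) \<in> constraint_manifold D Q" for J x y
  proof -
    have graph: "x t \<in> U \<and> y t = \<phi> (x t) \<and> (x t, y t) \<in> D" if "t \<in> J" for t
      using that \<open>\<forall>t\<in>J. _\<close> M_eq on_D by auto
    show ?thesis
      using graph_curve_solution_iff[OF graph \<phi>_deriv lift] graph by auto
  qed
  have "conservative (constraint_manifold D Q) (extended_field Q ft) Ht" if "conservative U f H"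
    using that rate unfolding conservative_def M_eq by auto
  moreover have "dissipative (constraint_manifold D Q) (extended_field Q ft) Ht"
    if "dissipative U f H"
    using that rate unfolding dissipative_def M_eq by auto
  ultimately show ?thesis
    using equiv by blast
qed

end
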